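(* There exists a countable field $F$ and a family, of cardinality $2^{\aleph_0}$, of pairwise non-isomorphic (as $F$-algebras) affine Noetherian $F$-algebras.
   Context: Algebras are associative and unital, not necessarily commutative. An $F$-algebra is affine if it is finitely generated as an $F$-algebra. Noetherian means left and right Noetherian. *)

theory Defs
  imports "HOL-Algebra.Algebra" "HOL-Library.Equipollence" "HOL-Library.Countable_Set"
begin

(* The HOL-Algebra locale "algebra" demands a commutative ring, and "noetherian_ring"
   refers to two-sided ideals only; the notions below are those of noncommutative algebra. *)

locale assoc_algebra = K?: field F + module F A + A?: ring A for F and A +
  assumes smult_mult_left:
      "\<lbrakk>c \<in> carrier F; x \<in> carrier A; y \<in> carrier A\<rbrakk> \<Longrightarrow> (c \<odot>\<^bsub>A\<^esub> x) \<otimes>\<^bsub>A\<^esub> y = c \<odot>\<^bsub>A\<^esub> (x \<otimes>\<^bsub>A\<^esub> y)"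
    and smult_mult_right:
      "\<lbrakk>c \<in> carrier F; x \<in> carrier A; y \<in> carrier A\<rbrakk> \<Longrightarrow> x \<otimes>\<^bsub>A\<^esub> (c \<odot>\<^bsub>A\<^esub> y) = c \<odot>\<^bsub>A\<^esub> (x \<otimes>\<^bsub>A\<^esub> y)"

(* "subring" includes closure under the unit of A. *)
definition unital_subalgebra ::
    "('a, 'm) ring_scheme \<Rightarrow> 'b set \<Rightarrow> ('a, 'b, 'n) module_scheme \<Rightarrow> bool" where
  "unital_subalgebra F B A \<longleftrightarrow>
     subring B A \<and> (\<forall>c\<in>carrier F. \<forall>x\<in>B. c \<odot>\<^bsub>A\<^esub> x \<in> B)"

definition generated_subalgebra ::
    "('a, 'm) ring_scheme \<Rightarrow> 'b set \<Rightarrow> ('a, 'b, 'n) module_scheme \<Rightarrow> 'b set" where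
  "generated_subalgebra F S A = \<Inter>{B. unital_subalgebra F B A \<and> S \<subseteq> B}"

definition affine_algebra ::
    "('a, 'm) ring_scheme \<Rightarrow> ('a, 'b, 'n) module_scheme \<Rightarrow> bool" where
  "affine_algebra F A \<longleftrightarrow> assoc_algebra F A \<and>
     (\<exists>S\<subseteq>carrier A. finite S \<and> generated_subalgebra F S A = carrier A)"

locale left_ideal = additive_subgroup I R + ring R for I and R (structure) +
  assumes left_closed: "\<lbrakk>a \<in> I; x \<in> carrier R\<rbrakk> \<Longrightarrow> x \<otimes> a \<in> I"

locale right_ideal = additive_subgroup I R + ring R for I and R (structure) +
  assumes right_closed: "\<lbrakk>a \<in> I; x \<in> carrier R\<rbrakk> \<Longrightarrow> a \<otimes> x \<in> I"

definition left_noetherian :: "('b, 'm) ring_scheme \<Rightarrow> bool" where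
  "left_noetherian R \<longleftrightarrow> ring R \<and>
     (\<forall>I :: nat \<Rightarrow> 'b set. (\<forall>n. left_ideal (I n) R) \<and> mono I \<longrightarrow> (\<exists>N. \<forall>n\<ge>N. I n = I N))"

definition right_noetherian :: "('b, 'm) ring_scheme \<Rightarrow> bool" where
  "right_noetherian R \<longleftrightarrow> ring R \<and>
     (\<forall>I :: nat \<Rightarrow> 'b set. (\<forall>n. right_ideal (I n) R) \<and> mono I \<longrightarrow> (\<exists>N. \<forall>n\<ge>N. I n = I N))"

definition two_sided_noetherian :: "('b, 'm) ring_scheme \<Rightarrow> bool" where
  "two_sided_noetherian R \<longleftrightarrow> left_noetherian R \<and> right_noetherian R"

definition algebra_isomorphic ::
    "('a, 'm) ring_scheme \<Rightarrow> ('a, 'b, 'n) module_scheme \<Rightarrow> ('a, 'c, 'k) module_scheme \<Rightarrow> bool" where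
  "algebra_isomorphic F A B \<longleftrightarrow>
     (\<exists>h\<in>ring_iso A B. \<forall>c\<in>carrier F. \<forall>x\<in>carrier A. h (c \<odot>\<^bsub>A\<^esub> x) = c \<odot>\<^bsub>B\<^esub> h x)"

(* Types cannot be quantified existentially, so an existence statement about countable
   structures takes them with carriers contained in nat. This loses no generality: every
   countable field, and every affine algebra over one (it is again countable), is
   isomorphic to a structure with carrier in nat. *)

end

theory Submission
  imports Defs "HOL-Library.Poly_Mapping" "HOL-Library.Z2" "HOL-Computational_Algebra.Polynomial"
    "HOL-Computational_Algebra.Fraction_Field"
begin

text \<open>
  Let \<open>K\<close> be the field of rational functions in \<open>t\<^sub>0, t\<^sub>1, \<dots>\<close> over the field with two elements, and let
  \<open>F\<close> be its subfield of squares, which is isomorphic to \<open>K\<close> and countable. Every derivation \<open>\<delta>\<close> of \<open>K\<close> is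
  \<open>F\<close>-linear, since \<open>\<delta>(c\<^sup>2) = 2 c \<delta>(c) = 0\<close>, so the differential operator ring \<open>K[x; \<delta>]\<close> is an
  \<open>F\<close>-algebra. Division with remainder makes all its one-sided ideals principal, so it is Noetherian.

  Derivations of \<open>K\<close> can be prescribed freely on the indeterminates (\<open>derivation_prescribed\<close>). For a set \<open>S\<close>
  of natural numbers, let \<open>\<delta>\<^sub>S\<close> send \<open>t\<^sub>i\<close> to \<open>t\<^sub>i\<^sub>+\<^sub>1\<close> or to \<open>t\<^sub>i\<^sub>+\<^sub>1 + 1\<close>, the latter exactly when
  \<open>i\<close> is the successor of an element of \<open>S\<close>. Commutators with \<open>x\<close> then produce all indeterminates from \<open>t\<^sub>0\<close>, and these generate \<open>K\<close>
  over \<open>F\<close> because \<open>K\<close> is algebraic over \<open>F\<close> (\<open>generated_by_indets\<close>); so \<open>t\<^sub>0\<close> and \<open>x\<close> generate the algebra.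

  An isomorphism from \<open>K[x; \<delta>]\<close> to \<open>K[x; \<delta>']\<close> over \<open>F\<close> preserves \<open>K\<close>, the set of units together with zero,
  and fixes it pointwise because \<open>K\<close> is purely inseparable over \<open>F\<close>. Comparing degrees, it sends \<open>x\<close> to
  some \<open>a x + b\<close>, whence \<open>\<delta> = a \<delta>'\<close> (\<open>ore_hom_rigid\<close>). For two derivations of the family \<open>a = 1\<close>,
  as both send \<open>t\<^sub>0\<close> to \<open>t\<^sub>1\<close>. Hence different sets \<open>S\<close> give non-isomorphic algebras.
\<close>

section \<open>Differential operator rings\<close>

lemma length_coeffs_diff_less:
  fixes f h :: "'a::comm_ring poly"
  assumes "f \<noteq> 0" "degree h = degree f" "lead_coeff h = lead_coeff f"
  shows "length (coeffs (f - h)) < length (coeffs f)"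
proof (cases "f - h = 0")
  case False
  have "degree (f - h) \<le> degree f"
    using assms degree_diff_le[of f "degree f" h] by simp
  moreover have "degree (f - h) \<noteq> degree f"
    using assms False by (metis coeff_diff diff_self leading_coeff_0_iff)
  ultimately show ?thesis
    using assms False by (simp add: length_coeffs_degree)
qed (use assms in \<open>simp add: length_coeffs_degree\<close>)

text \<open>
  Every derivation \<open>\<delta>\<close> of a field \<open>K\<close> defines the ring \<open>K[x; \<delta>]\<close> of skew polynomials
  \<open>\<Sum> a\<^sub>i x\<^sup>i\<close>, in which \<open>x a = a x + \<delta>(a)\<close>. It lives here on the type of ordinary polynomials over \<open>K\<close>,
  with coefficients written on the left and a second product, \<open>ore_mult\<close>.
\<close>

locale derivation =
  fixes \<delta> :: "'a::field \<Rightarrow> 'a"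
  assumes add: "\<delta> (a + b) = \<delta> a + \<delta> b"
    and Leibniz: "\<delta> (a * b) = \<delta> a * b + a * \<delta> b"
begin

lemma zero [simp]: "\<delta> 0 = 0"
  using add[of 0 0] by (metis add_0 add_cancel_right_right)

lemma one [simp]: "\<delta> 1 = 0"
  using Leibniz[of 1 1] by (metis add_cancel_right_right mult_1 mult_1_right)

text \<open>
  Left multiplication by \<open>x\<close>: as \<open>x\<close> moves past each coefficient, it adds the derivative of that coefficient.
\<close>

definition xmult :: "'a poly \<Rightarrow> 'a poly" where
  "xmult q = pCons 0 q + map_poly \<delta> q"

text \<open>
  The product of \<open>K[x; \<delta>]\<close>. Since \<open>p = \<Sum> a\<^sub>i x\<^sup>i\<close>, the product \<open>p q\<close> is obtained by applying the operator
  \<open>\<Sum> a\<^sub>i D\<^sup>i\<close> to \<open>q\<close>, where \<open>D\<close> is left multiplication by \<open>x\<close>.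
\<close>

definition ore_mult :: "'a poly \<Rightarrow> 'a poly \<Rightarrow> 'a poly" where
  "ore_mult p q = (\<Sum>i\<le>degree p. smult (coeff p i) ((xmult ^^ i) q))"

lemma coeff_xmult: "coeff (xmult q) n = coeff (pCons 0 q) n + \<delta> (coeff q n)"
  by (simp add: xmult_def coeff_map_poly)

lemma xmult_0 [simp]: "xmult 0 = 0"
  by (simp add: xmult_def)

lemma xmult_1 [simp]: "xmult 1 = [:0, 1:]"
  by (rule poly_eqI) (auto simp: coeff_xmult coeff_pCons split: nat.splits)

lemma xmult_add: "xmult (p + q) = xmult p + xmult q"
  by (rule poly_eqI) (auto simp: coeff_xmult coeff_pCons add split: nat.splits)

lemma xmult_smult: "xmult (smult a q) = smult (\<delta> a) q + smult a (xmult q)"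
  by (rule poly_eqI) (auto simp: coeff_xmult coeff_pCons Leibniz algebra_simps split: nat.splits)

lemma xmult_pCons: "xmult (pCons a q) = pCons (\<delta> a) ([:a:] + xmult q)"
  by (rule poly_eqI) (auto simp: coeff_xmult coeff_pCons split: nat.splits)

lemma ore_mult_eq_sum:
  assumes "degree p \<le> n"
  shows "ore_mult p q = (\<Sum>i\<le>n. smult (coeff p i) ((xmult ^^ i) q))"
  unfolding ore_mult_def using assms
  by (intro sum.mono_neutral_left) (auto simp: coeff_eq_0)

lemma ore_mult_0 [simp]: "ore_mult 0 q = 0"
  by (simp add: ore_mult_def)

lemma ore_mult_pCons [simp]: "ore_mult (pCons a p) q = smult a q + ore_mult p (xmult q)"
proof -
  have "ore_mult (pCons a p) q = (\<Sum>i\<le>Suc (degree p). smult (coeff (pCons a p) i) ((xmult ^^ i) q))"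
    by (intro ore_mult_eq_sum degree_pCons_le)
  also have "\<dots> = smult a q + (\<Sum>i\<le>degree p. smult (coeff p i) ((xmult ^^ i) (xmult q)))"
    by (subst sum.atMost_Suc_shift) (simp add: funpow_swap1)
  finally show ?thesis by (simp add: ore_mult_def)
qed

lemma ore_mult_add_left: "ore_mult (p + p') q = ore_mult p q + ore_mult p' q"
proof -
  let ?n = "max (degree p) (degree p')"
  show ?thesis
    using ore_mult_eq_sum[of "p + p'" ?n q] ore_mult_eq_sum[of p ?n q] ore_mult_eq_sum[of p' ?n q]
    by (simp add: degree_add_le smult_add_left sum.distrib)
qed

lemma ore_mult_smult_left: "ore_mult (smult a p) q = smult a (ore_mult p q)"
  by (induction p arbitrary: q) (simp_all add: smult_add_right)

lemma ore_mult_add_right: "ore_mult p (q + q') = ore_mult p q + ore_mult p q'"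
  by (induction p arbitrary: q q') (simp_all add: xmult_add smult_add_right)

lemma ore_mult_0_right [simp]: "ore_mult p 0 = 0"
  using ore_mult_add_right[of p 0 0] by (metis add_0 add_cancel_right_right)

lemma ore_mult_xmult_right: "ore_mult p (xmult q) = ore_mult (pCons 0 p) q"
  by simp

lemma ore_mult_1 [simp]: "ore_mult 1 q = q"
  by (simp add: one_pCons)

lemma ore_mult_1_right [simp]: "ore_mult p 1 = p"
proof -
  have "xmult (monom 1 i) = monom 1 (Suc i)" for i
    by (rule poly_eqI) (simp add: coeff_xmult coeff_pCons split: nat.split)
  then have pow: "(xmult ^^ i) 1 = monom 1 i" for i
    by (induction i) (simp_all add: monom_0 one_pCons[symmetric])
  show ?thesis
    unfolding ore_mult_def pow by (simp add: smult_monom poly_as_sum_of_monoms)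
qed

lemma ore_mult_x_right [simp]: "ore_mult p [:0, 1:] = pCons 0 p"
  using ore_mult_xmult_right[of p 1] unfolding xmult_1 ore_mult_1_right .

text \<open>
  The case \<open>x (p q) = (x p) q\<close> of associativity, from which the general case follows by induction
  on the left factor.
\<close>

lemma xmult_ore_mult: "xmult (ore_mult p q) = ore_mult (xmult p) q"
proof (induction p arbitrary: q)
  case (pCons a p)
  then show ?case
    by (simp add: xmult_add xmult_smult xmult_pCons ore_mult_add_left)
qed simp

lemma ore_mult_assoc: "ore_mult (ore_mult p q) r = ore_mult p (ore_mult q r)"
  by (induction p arbitrary: q)
    (simp_all add: ore_mult_add_left ore_mult_smult_left xmult_ore_mult)

text \<open>
  Constants of the derivation are central.
\<close>

lemma ore_mult_smult_constant:
  assumes "\<delta> c = 0"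
  shows "ore_mult p (smult c q) = smult c (ore_mult p q)"
  using assms by (induction p arbitrary: q) (simp_all add: xmult_smult smult_add_right mult.commute)

lemma degree_xmult: "q \<noteq> 0 \<Longrightarrow> degree (xmult q) = Suc (degree q)"
  and lead_coeff_xmult: "q \<noteq> 0 \<Longrightarrow> lead_coeff (xmult q) = lead_coeff q"
proof -
  assume q: "q \<noteq> 0"
  show deg: "degree (xmult q) = Suc (degree q)"
  proof (rule antisym)
    show "degree (xmult q) \<le> Suc (degree q)"
      by (rule degree_le) (auto simp: coeff_xmult coeff_pCons coeff_eq_0 split: nat.splits)
    show "Suc (degree q) \<le> degree (xmult q)"
      by (rule le_degree) (use q in \<open>simp add: coeff_xmult coeff_eq_0\<close>)
  qed
  show "lead_coeff (xmult q) = lead_coeff q"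
    by (simp add: deg coeff_xmult coeff_eq_0)
qed

lemma ore_mult_degree_lead_coeff:
  assumes "p \<noteq> 0" "q \<noteq> 0"
  shows "degree (ore_mult p q) = degree p + degree q \<and>
    lead_coeff (ore_mult p q) = lead_coeff p * lead_coeff q"
  using assms
proof (induction p arbitrary: q)
  case (pCons a p)
  show ?case
  proof (cases "p = 0")
    case True
    with pCons show ?thesis by simp
  next
    case False
    have "xmult q \<noteq> 0"
      using degree_xmult[OF \<open>q \<noteq> 0\<close>] by auto
    with pCons.IH[OF False this] degree_xmult[of q] lead_coeff_xmult[of q] \<open>q \<noteq> 0\<close>
    have deg: "degree (ore_mult p (xmult q)) = Suc (degree p + degree q)"
      and lc: "lead_coeff (ore_mult p (xmult q)) = lead_coeff p * lead_coeff q"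
      by auto
    have less: "degree (smult a q) < degree (ore_mult p (xmult q))"
      using deg degree_smult_le[of a q] by linarith
    show ?thesis
      using degree_add_eq_right[OF less] lead_coeff_add_le[OF less] deg lc False by simp
  qed
qed simp

lemma degree_ore_mult: "p \<noteq> 0 \<Longrightarrow> q \<noteq> 0 \<Longrightarrow> degree (ore_mult p q) = degree p + degree q"
  and lead_coeff_ore_mult:
    "p \<noteq> 0 \<Longrightarrow> q \<noteq> 0 \<Longrightarrow> lead_coeff (ore_mult p q) = lead_coeff p * lead_coeff q"
  using ore_mult_degree_lead_coeff by blast+

lemma ore_mult_eq_0_iff [simp]: "ore_mult p q = 0 \<longleftrightarrow> p = 0 \<or> q = 0"
  using lead_coeff_ore_mult[of p q] by fastforce

lemma ore_mult_eq_1_imp_const: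
  assumes "ore_mult p q = 1"
  shows "degree p = 0"
proof -
  have "p \<noteq> 0" "q \<noteq> 0" using assms by auto
  with degree_ore_mult[of p q] assms show ?thesis by simp
qed

text \<open>
  One step of division with remainder, on either side: a monomial multiple of \<open>g\<close> cancels the leading
  term of \<open>f\<close>. The length of the coefficient list measures the size of a polynomial, so that \<open>0\<close> is
  strictly smaller than the nonzero constants.
\<close>

lemma left_division_step:
  assumes "f \<noteq> 0" "g \<noteq> 0" "degree g \<le> degree f"
  obtains p where "length (coeffs (f - ore_mult p g)) < length (coeffs f)"
proof
  let ?p = "monom (lead_coeff f / lead_coeff g) (degree f - degree g)"
  have deg: "degree ?p = degree f - degree g" and lc: "lead_coeff ?p = lead_coeff f / lead_coeff g"
    and "?p \<noteq> 0"
    using assms by (simp_all add: degree_monom_eq)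
  then have "degree (ore_mult ?p g) = degree f" "lead_coeff (ore_mult ?p g) = lead_coeff f"
    using assms degree_ore_mult[of "?p" "g"] lead_coeff_ore_mult[of "?p" "g"] by auto
  then show "length (coeffs (f - ore_mult ?p g)) < length (coeffs f)"
    using assms by (intro length_coeffs_diff_less)
qed

lemma right_division_step:
  assumes "f \<noteq> 0" "g \<noteq> 0" "degree g \<le> degree f"
  obtains p where "length (coeffs (f - ore_mult g p)) < length (coeffs f)"
proof
  let ?p = "monom (lead_coeff f / lead_coeff g) (degree f - degree g)"
  have deg: "degree ?p = degree f - degree g" and lc: "lead_coeff ?p = lead_coeff f / lead_coeff g"
    and "?p \<noteq> 0"
    using assms by (simp_all add: degree_monom_eq)
  then have "degree (ore_mult g ?p) = degree f" "lead_coeff (ore_mult g ?p) = lead_coeff f"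
    using assms degree_ore_mult[of "g" "?p"] lead_coeff_ore_mult[of "g" "?p"] by auto
  then show "length (coeffs (f - ore_mult g ?p)) < length (coeffs f)"
    using assms by (intro length_coeffs_diff_less)
qed

end

text \<open>
  The usual argument that a Euclidean ring is a principal ideal ring, in a form that serves left and
  right ideals alike: a nonzero element of least degree in the union of the chain lies in some member
  \<open>I N\<close>, and division by it shows that the union is contained in \<open>I N\<close>.
\<close>

lemma chain_stabilises:
  fixes I :: "nat \<Rightarrow> 'a::field poly set"
  assumes mono: "mono I"
    and zero: "\<And>n. 0 \<in> I n"
    and diff: "\<And>n f h. f \<in> I n \<Longrightarrow> h \<in> I n \<Longrightarrow> f - h \<in> I n"
    and step: "\<And>n f g. \<lbrakk>g \<in> I n; g \<noteq> 0; f \<noteq> 0; degree g \<le> degree f\<rbrakk> \<Longrightarrow>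
      \<exists>h\<in>I n. length (coeffs (f - h)) < length (coeffs f)"
  shows "\<exists>N. \<forall>n\<ge>N. I n = I N"
proof (cases "\<exists>g. g \<noteq> 0 \<and> (\<exists>n. g \<in> I n)")
  case True
  then obtain g where g: "g \<noteq> 0 \<and> (\<exists>n. g \<in> I n)"
    and "\<forall>f. f \<noteq> 0 \<and> (\<exists>n. f \<in> I n) \<longrightarrow> degree g \<le> degree f"
    using ex_has_least_nat[of "\<lambda>g. g \<noteq> 0 \<and> (\<exists>n. g \<in> I n)" _ degree] by blast
  then have min: "degree g \<le> degree f" if "f \<noteq> 0" "f \<in> I n" for f n
    using that by blast
  from g obtain N where N: "g \<in> I N" by blast
  have "f \<in> I N" if "f \<in> I n" "n \<ge> N" for f n
    using that
  proof (induction "length (coeffs f)" arbitrary: f rule: less_induct)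
    case less
    show ?case
    proof (cases "f = 0")
      case False
      with less.prems min have "degree g \<le> degree f" by blast
      with step[OF N, of f] g False obtain h where h: "h \<in> I N" "length (coeffs (f - h)) < length (coeffs f)"
        by blast
      have "h \<in> I n" using h mono less.prems by (auto dest: monoD)
      with h less diff have "f - h \<in> I N" by blast
      then have "(f - h) - (0 - h) \<in> I N" using h zero diff by blast
      then show ?thesis by simp
    qed (use zero in simp)
  qed
  moreover have "I N \<subseteq> I n" if "n \<ge> N" for n
    using that mono by (rule monoD[rotated])
  ultimately show ?thesis by blast
next
  case False
  then have "I n = {0}" for n using zero by blast
  then show ?thesis by simp
qed

section \<open>Derivations of a rational function field in characteristic 2\<close>

text \<open>
  A derivation of a domain \<open>R\<close> with values in its fraction field extends to the fraction field.
\<close>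

lemma fract_derivation_extension:
  fixes d :: "'r::idom \<Rightarrow> 'r fract"
  assumes add: "\<And>a b. d (a + b) = d a + d b"
    and Leibniz: "\<And>a b. d (a * b) = d a * Fract b 1 + Fract a 1 * d b"
  obtains \<delta> where "derivation \<delta>" "\<And>a. \<delta> (Fract a 1) = d a"
proof -
  define \<iota> :: "'r \<Rightarrow> 'r fract" where "\<iota> a = Fract a 1" for a
  have \<iota>_add: "\<iota> (a + b) = \<iota> a + \<iota> b" and \<iota>_mult: "\<iota> (a * b) = \<iota> a * \<iota> b"
    and \<iota>_eq: "\<iota> a = \<iota> b \<longleftrightarrow> a = b" for a b
    by (simp_all add: \<iota>_def eq_fract)
  have \<iota>_0: "\<iota> a = 0 \<longleftrightarrow> a = 0" and \<iota>_1: "\<iota> 1 = 1" for a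
    by (simp_all add: \<iota>_def Zero_fract_def One_fract_def eq_fract)
  have d_1: "d 1 = 0"
    using Leibniz[of 1 1] \<iota>_1 by (metis \<iota>_def add_cancel_right_right mult_1 mult_1_right)
  have frac: "\<exists>a b. b \<noteq> 0 \<and> \<iota> a = z * \<iota> b" for z
    by (cases z) (auto simp: \<iota>_def eq_fract intro!: exI)
  \<comment> \<open>If \<open>z = a / b\<close>, then the product rule for \<open>a = z b\<close> determines the derivative \<open>y\<close> of \<open>z\<close>; this
     equation, rather than the quotient rule, is taken as the definition.\<close>
  define Q where "Q z y a b \<longleftrightarrow> b \<noteq> 0 \<and> \<iota> a = z * \<iota> b \<and> d a = y * \<iota> b + z * d b" for z y a b
  have transfer: "Q z y a' b'" if "Q z y a b" "b' \<noteq> 0" "\<iota> a' = z * \<iota> b'" for z y a b a' b'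
  proof -
    have "\<iota> (a * b') = \<iota> (a' * b)"
      using that by (simp add: Q_def \<iota>_mult)
    then have "d (a * b') = d (a' * b)"
      by (simp add: \<iota>_eq)
    then have "d a * \<iota> b' + \<iota> a * d b' = d a' * \<iota> b + \<iota> a' * d b"
      by (simp add: Leibniz \<iota>_def)
    then have "\<iota> b * (y * \<iota> b' + z * d b') = \<iota> b * d a'"
      using that by (simp add: Q_def algebra_simps)
    then have "y * \<iota> b' + z * d b' = d a'"
      using that by (simp add: Q_def \<iota>_0)
    then show ?thesis
      using that by (simp add: Q_def)
  qed
  define \<delta> where "\<delta> z = (THE y. \<exists>a b. Q z y a b)" for z
  have \<delta>_eqI: "\<delta> z = y" if "Q z y a b" for z y a b
    unfolding \<delta>_def
  proof (rule the_equality)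
    fix y' assume "\<exists>a b. Q z y' a b"
    then have "Q z y' a b"
      using transfer that unfolding Q_def by blast
    then show "y' = y"
      using that by (simp add: Q_def \<iota>_0)
  qed (use that in blast)
  have \<delta>_spec: "Q z (\<delta> z) a b" if "b \<noteq> 0" "\<iota> a = z * \<iota> b" for z a b
  proof -
    have "Q z ((d a - z * d b) / \<iota> b) a b"
      using that by (simp add: Q_def \<iota>_0)
    with \<delta>_eqI show ?thesis by metis
  qed
  have "derivation \<delta>"
  proof
    fix z w
    obtain a b where ab: "b \<noteq> 0" "\<iota> a = z * \<iota> b" using frac by blast
    obtain c e where ce: "e \<noteq> 0" "\<iota> c = w * \<iota> e" using frac by blast
    have d: "d a = \<delta> z * \<iota> b + z * d b" "d c = \<delta> w * \<iota> e + w * d e"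
      using \<delta>_spec[OF ab] \<delta>_spec[OF ce] by (simp_all add: Q_def)
    have d_mult: "d (f * g) = d f * \<iota> g + \<iota> f * d g" for f g
      by (simp add: Leibniz \<iota>_def)
    have "Q (z + w) (\<delta> z + \<delta> w) (a * e + c * b) (b * e)"
      using ab ce by (simp add: Q_def add d_mult d \<iota>_add \<iota>_mult algebra_simps)
    then show "\<delta> (z + w) = \<delta> z + \<delta> w" by (rule \<delta>_eqI)
    have "Q (z * w) (\<delta> z * w + z * \<delta> w) (a * c) (b * e)"
      using ab ce by (simp add: Q_def d_mult d \<iota>_mult algebra_simps)
    then show "\<delta> (z * w) = \<delta> z * w + z * \<delta> w" by (rule \<delta>_eqI)
  qed
  moreover have "\<delta> (Fract a 1) = d a" for a
    by (rule \<delta>_eqI[of _ _ a 1]) (simp add: Q_def \<iota>_1 d_1, simp add: \<iota>_def)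
  ultimately show ?thesis using that by blast
qed

lemma poly_mapping_add_induct [case_names zero add]:
  assumes "P 0" and "\<And>m c p. P p \<Longrightarrow> P (Poly_Mapping.single m c + p)"
  shows "P (p :: 'm \<Rightarrow>\<^sub>0 'c::monoid_add)"
proof (induction p rule: update_induct)
  case (update p m c)
  have "Poly_Mapping.update m c p = Poly_Mapping.single m c + p"
    using update by (intro poly_mapping_eqI)
      (auto simp: lookup_update lookup_add lookup_single in_keys_iff when_def)
  with update assms show ?case by simp
qed (use assms in simp)

text \<open>
  Write \<open>t\<^sup>m\<close> for the monomial with exponent \<open>m\<close>. Any additive map \<open>\<l>\<close> on exponents is the logarithmic
  derivative of a derivation \<open>t\<^sup>m \<mapsto> t\<^sup>m \<l>(m)\<close>. The product rule holds on monomials because \<open>\<l>\<close> is additive,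
  hence everywhere.
\<close>

lemma logarithmic_derivation_exists:
  fixes \<l> :: "'m::{ordered_cancel_comm_monoid_add, linorder} \<Rightarrow> ('m \<Rightarrow>\<^sub>0 'c::idom) fract"
  assumes \<l>_add: "\<And>m n. \<l> (m + n) = \<l> m + \<l> n"
  obtains \<delta> where "derivation \<delta>"
    "\<And>m c. \<delta> (Fract (Poly_Mapping.single m c) 1) = Fract (Poly_Mapping.single m c) 1 * \<l> m"
proof -
  define \<iota> :: "('m \<Rightarrow>\<^sub>0 'c) \<Rightarrow> ('m \<Rightarrow>\<^sub>0 'c) fract" where "\<iota> a = Fract a 1" for a
  have \<iota>_add: "\<iota> (a + b) = \<iota> a + \<iota> b" and \<iota>_mult: "\<iota> (a * b) = \<iota> a * \<iota> b"
    and \<iota>_0: "\<iota> 0 = 0" for a b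
    by (simp_all add: \<iota>_def Zero_fract_def)
  define d where
    "d p = (\<Sum>m\<in>Poly_Mapping.keys p. \<iota> (Poly_Mapping.single m (Poly_Mapping.lookup p m)) * \<l> m)" for p
  have d_add: "d (p + q) = d p + d q" for p q
    unfolding d_def
    by (rule setsum_keys_plus_distrib) (simp_all add: \<iota>_0 single_add \<iota>_add distrib_right)
  have d_0: "d 0 = 0"
    by (simp add: d_def)
  have d_single: "d (Poly_Mapping.single m c) = \<iota> (Poly_Mapping.single m c) * \<l> m" for m c
    by (simp add: d_def \<iota>_0)
  have d_mult_single: "d (Poly_Mapping.single m c * q) =
      d (Poly_Mapping.single m c) * \<iota> q + \<iota> (Poly_Mapping.single m c) * d q" for m c q
  proof (induction q rule: poly_mapping_add_induct)
    case (add n b q)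
    have "d (Poly_Mapping.single m c * Poly_Mapping.single n b) =
      d (Poly_Mapping.single m c) * \<iota> (Poly_Mapping.single n b) +
      \<iota> (Poly_Mapping.single m c) * d (Poly_Mapping.single n b)"
    proof -
      have "d (Poly_Mapping.single m c * Poly_Mapping.single n b) =
        \<iota> (Poly_Mapping.single m c * Poly_Mapping.single n b) * (\<l> m + \<l> n)"
        by (simp only: mult_single d_single \<l>_add)
      then show ?thesis by (simp add: \<iota>_mult d_single algebra_simps)
    qed
    with add show ?case by (simp add: distrib_left d_add \<iota>_add)
  qed (simp add: d_0 \<iota>_0)
  have "d (p * q) = d p * \<iota> q + \<iota> p * d q" for p q
  proof (induction p rule: poly_mapping_add_induct)
    case (add m c p)
    then show ?case by (simp add: distrib_right d_add d_mult_single \<iota>_add)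
  qed (simp add: d_0 \<iota>_0)
  then obtain \<delta> where "derivation \<delta>" "\<And>a. \<delta> (Fract a 1) = d a"
    using fract_derivation_extension[of d] d_add unfolding \<iota>_def by metis
  then show ?thesis
    using that d_single by (simp add: \<iota>_def)
qed

text \<open>
  The field \<open>K\<close> of rational functions over the field with two elements in countably many indeterminates:
  an exponent is a finitely supported function \<open>nat \<Rightarrow>\<^sub>0 nat\<close>.
\<close>

type_synonym function_field = "((nat \<Rightarrow>\<^sub>0 nat) \<Rightarrow>\<^sub>0 bit) fract"

text \<open>
  The indeterminate \<open>t\<^sub>i\<close>.
\<close>

definition indet :: "nat \<Rightarrow> function_field" where
  "indet i = Fract (Poly_Mapping.single (Poly_Mapping.single i 1) 1) 1"

lemma indet_nonzero: "indet i \<noteq> 0"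
  by (auto simp: indet_def Zero_fract_def eq_fract dest!: arg_cong[where f = Poly_Mapping.keys])

lemma function_field_double: "z + z = (0 :: function_field)"
proof -
  have "(1::(nat \<Rightarrow>\<^sub>0 nat) \<Rightarrow>\<^sub>0 bit) + 1 = 0"
    by (simp add: single_add[symmetric] flip: single_one)
  then have "(1::function_field) + 1 = 0"
    by (simp add: One_fract_def Zero_fract_def eq_fract)
  then have "z * (1 + 1) = 0" by (simp only: mult_zero_right)
  then show ?thesis by (simp only: distrib_left mult_1_right)
qed

text \<open>
  A derivation may take arbitrary values \<open>e\<^sub>i\<close> on the indeterminates: its logarithmic derivative is
  \<open>\<l>(m) = \<Sum> m\<^sub>i e\<^sub>i / t\<^sub>i\<close>.
\<close>

lemma derivation_prescribed:
  fixes e :: "nat \<Rightarrow> function_field"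
  shows "\<exists>\<delta>. derivation \<delta> \<and> (\<forall>i. \<delta> (indet i) = e i)"
proof -
  define \<l> where
    "\<l> m = (\<Sum>i\<in>Poly_Mapping.keys m. of_nat (Poly_Mapping.lookup m i) * (e i / indet i))" for m :: "nat \<Rightarrow>\<^sub>0 nat"
  have "\<l> (m + n) = \<l> m + \<l> n" for m n
    unfolding \<l>_def by (rule setsum_keys_plus_distrib) (simp_all add: distrib_right add_divide_distrib)
  then obtain \<delta> where \<delta>: "derivation \<delta>"
    "\<And>m c. \<delta> (Fract (Poly_Mapping.single m c) 1) = Fract (Poly_Mapping.single m c) 1 * \<l> m"
    using logarithmic_derivation_exists[of \<l>] by metis
  have "\<delta> (indet i) = indet i * \<l> (Poly_Mapping.single i 1)" for i
    using \<delta>(2) unfolding indet_def .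
  then have "\<delta> (indet i) = e i" for i
    using indet_nonzero[of i] by (simp add: \<l>_def)
  with \<delta> show ?thesis by blast
qed

text \<open>
  The indeterminates generate \<open>K\<close> as an algebra over its subfield of squares. Inverses come for free, since
  \<open>inverse z = (inverse z)\<^sup>2 z\<close> is a multiple of \<open>z\<close> by a square.
\<close>

lemma generated_by_indets:
  fixes C :: "function_field set"
  assumes one: "1 \<in> C"
    and add: "\<And>z w. z \<in> C \<Longrightarrow> w \<in> C \<Longrightarrow> z + w \<in> C"
    and mult: "\<And>z w. z \<in> C \<Longrightarrow> w \<in> C \<Longrightarrow> z * w \<in> C"
    and square: "\<And>c z. z \<in> C \<Longrightarrow> c\<^sup>2 * z \<in> C"
    and indets: "\<And>i. indet i \<in> C"
  shows "C = UNIV"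
proof -
  have zero: "0 \<in> C"
    using square[OF one, of 0] by simp
  have inv: "inverse z \<in> C" if "z \<in> C" for z
  proof (cases "z = 0")
    case False
    then have "inverse z = (inverse z)\<^sup>2 * z"
      by (simp add: power2_eq_square)
    with square[OF that, of "inverse z"] show ?thesis by simp
  qed (use zero in simp)
  have single: "Fract (Poly_Mapping.single (Poly_Mapping.single i k) 1) 1 \<in> C" for i k
  proof (induction k)
    case 0
    then show ?case using one by (simp add: One_fract_def)
  next
    case (Suc k)
    have "Fract (Poly_Mapping.single (Poly_Mapping.single i (Suc k)) 1) 1 =
      indet i * Fract (Poly_Mapping.single (Poly_Mapping.single i k) 1) 1"
      by (simp add: indet_def mult_single flip: single_add)
    with mult[OF indets Suc] show ?case by simp
  qed
  have monomial: "Fract (Poly_Mapping.single m 1) 1 \<in> C" for m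
  proof (induction m rule: poly_mapping_add_induct)
    case zero
    then show ?case using one by (simp add: One_fract_def)
  next
    case (add i k m)
    have "Fract (Poly_Mapping.single (Poly_Mapping.single i k + m) 1) 1 =
      Fract (Poly_Mapping.single (Poly_Mapping.single i k) 1) 1 * (Fract (Poly_Mapping.single m 1) 1 :: function_field)"
      by (simp add: mult_single)
    with mult[OF single add] show ?case by simp
  qed
  have polynomial: "Fract p 1 \<in> C" for p
  proof (induction p rule: poly_mapping_add_induct)
    case zero
    then show ?case using \<open>0 \<in> C\<close> by (simp add: Zero_fract_def)
  next
    case (add m c p)
    have "Fract (Poly_Mapping.single m c) 1 \<in> C"
      using monomial \<open>0 \<in> C\<close> by (cases c) (simp_all add: Zero_fract_def)
    moreover have "Fract (Poly_Mapping.single m c + p) 1 = Fract (Poly_Mapping.single m c) 1 + (Fract p 1 :: function_field)"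
      by simp
    ultimately show ?case using assms(2) add by metis
  qed
  have "z \<in> C" for z
  proof (cases z)
    case (Fract a b)
    then have "z = Fract a 1 * inverse (Fract b 1)" by simp
    with mult polynomial inv show ?thesis by metis
  qed
  then show ?thesis by blast
qed

section \<open>Rigidity of homomorphisms\<close>

lemma degree_const_add: "degree ([:c:] + r) = degree r"
  by (cases r) simp

text \<open>
  A surjective ring homomorphism \<open>h\<close> between two such rings that fixes the squares of \<open>K\<close> forces the derivations
  to be proportional. Units of \<open>K[x; \<delta>]\<close> have degree \<open>0\<close>, so \<open>h\<close> maps \<open>K\<close> into \<open>K\<close>; it fixes squares, and in
  characteristic 2 square roots are unique, so it fixes \<open>K\<close> pointwise. By surjectivity \<open>h(x) = a x + b\<close>,
  and the image of the relation \<open>x c = c x + \<delta>(c)\<close> reads \<open>\<delta>(c) = a \<delta>'(c)\<close>.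
\<close>

lemma ore_hom_rigid:
  fixes \<delta> \<delta>' :: "'a::field \<Rightarrow> 'a"
  assumes \<delta>: "derivation \<delta>" and \<delta>': "derivation \<delta>'" and char2: "\<And>c::'a. c + c = 0"
    and surj: "surj h"
    and h_add: "\<And>p q. h (p + q) = h p + h q"
    and h_mult: "\<And>p q. h (derivation.ore_mult \<delta> p q) = derivation.ore_mult \<delta>' (h p) (h q)"
    and h_1: "h 1 = 1"
    and h_square: "\<And>c. h [:c\<^sup>2:] = [:c\<^sup>2:]"
  shows "\<exists>a. \<forall>c. \<delta> c = a * \<delta>' c"
proof -
  interpret A: derivation \<delta> by fact
  interpret B: derivation \<delta>' by fact
  have h_0: "h 0 = 0"
    using h_add[of 0 0] by (metis add_0 add_cancel_right_right)
  have h_const: "h [:c:] = [:c:]" for c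
  proof (cases "c = 0")
    case False
    have "A.ore_mult [:c:] [:inverse c:] = 1"
      using False by (simp add: one_pCons)
    then have "B.ore_mult (h [:c:]) (h [:inverse c:]) = 1"
      using h_mult h_1 by metis
    then have "degree (h [:c:]) = 0"
      by (rule B.ore_mult_eq_1_imp_const)
    then obtain d where d: "h [:c:] = [:d:]"
      by (rule degree_eq_zeroE)
    have "A.ore_mult [:c:] [:c:] = [:c\<^sup>2:]"
      by (simp add: power2_eq_square)
    then have "B.ore_mult [:d:] [:d:] = [:c\<^sup>2:]"
      using h_mult h_square d by metis
    then have "d\<^sup>2 = c\<^sup>2"
      by (simp add: power2_eq_square)
    then have "d = c \<or> d = - c"
      by (simp add: power2_eq_iff)
    moreover have "- c = c"
      using char2[of c] by (simp add: eq_neg_iff_add_eq_0)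
    ultimately show ?thesis using d by auto
  qed (simp add: h_0)
  define p where "p = h [:0, 1:]"
  have h_pCons: "h (pCons c q) = [:c:] + B.ore_mult (h q) p" for c q
  proof -
    have "pCons c q = [:c:] + A.ore_mult q [:0, 1:]" by simp
    then show ?thesis by (simp only: h_add h_mult h_const p_def)
  qed
  \<comment> \<open>Degrees add under multiplication, so the degree of every \<open>h q\<close> is a multiple of that of \<open>p\<close>; yet some
     \<open>h q\<close> has degree 1.\<close>
  have "degree p = 1"
  proof (rule ccontr)
    assume p: "degree p \<noteq> 1"
    have "degree (h q) \<noteq> 1" for q
    proof (induction q)
      case (pCons c q)
      show ?case
      proof (cases "h q = 0 \<or> p = 0")
        case True
        then show ?thesis by (auto simp: h_pCons)
      next
        case False
        then have "degree (h (pCons c q)) = degree (h q) + degree p"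
          by (simp add: h_pCons degree_const_add B.degree_ore_mult)
        with pCons p show ?thesis by linarith
      qed
    qed (simp add: h_0)
    moreover obtain q where "h q = [:0, 1:]"
      using surj by (metis surjD)
    ultimately show False by (metis degree_pCons_eq_if degree_1 one_pCons one_neq_zero One_nat_def pCons_eq_0_iff)
  qed
  then obtain a b where p: "p = [:b, a:]"
    by (metis degree1_coeffs)
  have "\<delta> c = a * \<delta>' c" for c
  proof -
    have "A.ore_mult [:0, 1:] [:c:] = [:\<delta> c:] + A.ore_mult [:c:] [:0, 1:]"
      by (simp add: A.xmult_pCons)
    then have "B.ore_mult p [:c:] = [:\<delta> c:] + B.ore_mult [:c:] p"
      using h_add h_mult h_const p_def by metis
    then show ?thesis
      by (simp add: p B.xmult_pCons algebra_simps)
  qed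
  then show ?thesis by blast
qed

section \<open>Coding countable structures on the natural numbers\<close>

instance poly :: ("{zero, countable}") countable
  by (rule countable_classI[of "\<lambda>p. to_nat (coeffs p)"]) (simp add: coeffs_eq_iff)

instance poly_mapping :: (countable, "{zero, countable}") countable
proof
  define graph where "graph p = (\<lambda>x. (x, Poly_Mapping.lookup p x)) ` Poly_Mapping.keys p" for p :: "'a \<Rightarrow>\<^sub>0 'b"
  define enum where "enum p = (SOME xs. set xs = graph p)" for p
  have enum: "set (enum p) = graph p" for p
    unfolding enum_def by (rule someI_ex) (simp add: finite_list graph_def)
  have "p = q" if "graph p = graph q" for p q
  proof (rule poly_mapping_eqI)
    fix x
    have "x \<in> Poly_Mapping.keys r \<longleftrightarrow> (x, Poly_Mapping.lookup r x) \<in> graph r"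
      and "(x, y) \<in> graph r \<Longrightarrow> y = Poly_Mapping.lookup r x" for r y
      by (auto simp: graph_def)
    with that show "Poly_Mapping.lookup p x = Poly_Mapping.lookup q x"
      by (metis in_keys_iff)
  qed
  with enum have "inj enum" by (metis injI)
  then have "inj (to_nat \<circ> enum)" by (intro inj_compose) simp_all
  then show "\<exists>f :: ('a \<Rightarrow>\<^sub>0 'b) \<Rightarrow> nat. inj f" by blast
qed

instance fract :: ("{idom, countable}") countable
proof
  have "\<exists>x. z = Fract (fst x) (snd x)" for z :: "'a fract"
    by (cases z) auto
  then obtain r where "\<And>z :: 'a fract. z = Fract (fst (r z)) (snd (r z))" by metis
  then have "inj r" by (metis injI)
  then have "inj (to_nat \<circ> r)" by (intro inj_compose) simp_all
  then show "\<exists>f :: 'a fract \<Rightarrow> nat. inj f" by blast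
qed

instance bit :: countable
  by (rule countable_classI[of "\<lambda>b. if b = 0 then 0 else 1"]) (auto split: if_splits)

text \<open>
  The field \<open>'a\<close> transported to a set of natural numbers along the injection \<open>to_nat\<close>.
\<close>

definition field_code :: "'a::{field, countable} itself \<Rightarrow> nat ring" where
  "field_code _ = \<lparr>carrier = range (to_nat :: 'a \<Rightarrow> nat),
     monoid.mult = \<lambda>a b. to_nat (from_nat a * from_nat b :: 'a), monoid.one = to_nat (1 :: 'a),
     ring.zero = to_nat (0 :: 'a), ring.add = \<lambda>a b. to_nat (from_nat a + from_nat b :: 'a)\<rparr>"

lemma field_field_code: "field (field_code TYPE('a::{field, countable}))"
proof -
  let ?F = "field_code TYPE('a)"
  have "abelian_group ?F"
  proof (rule abelian_groupI)
    fix x assume "x \<in> carrier ?F"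
    then obtain a :: 'a where "x = to_nat a" by (auto simp: field_code_def)
    then show "\<exists>y\<in>carrier ?F. y \<oplus>\<^bsub>?F\<^esub> x = \<zero>\<^bsub>?F\<^esub>"
      by (intro bexI[of _ "to_nat (- a)"]) (auto simp: field_code_def)
  qed (auto simp: field_code_def add_ac)
  moreover have "comm_monoid ?F"
    by (rule comm_monoidI) (auto simp: field_code_def mult_ac)
  ultimately interpret cring ?F
    by (rule cringI) (auto simp: field_code_def distrib_right)
  show ?thesis
  proof (rule cring_fieldI2)
    fix x assume "x \<in> carrier ?F" "x \<noteq> \<zero>\<^bsub>?F\<^esub>"
    then obtain a :: 'a where "x = to_nat a" "a \<noteq> 0" by (auto simp: field_code_def)
    then show "\<exists>y\<in>carrier ?F. x \<otimes>\<^bsub>?F\<^esub> y = \<one>\<^bsub>?F\<^esub>"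
      by (intro bexI[of _ "to_nat (inverse a)"]) (auto simp: field_code_def)
  qed (simp add: field_code_def)
qed

section \<open>Differential operator rings as affine Noetherian algebras\<close>

locale char2_derivation = derivation \<delta> for \<delta> :: "'a::{field, countable} \<Rightarrow> 'a" +
  assumes double: "(c::'a) + c = 0"
begin

text \<open>
  The ring \<open>K[x; \<delta>]\<close>, transported to the natural numbers, as an algebra over its central subfield of
  squares. That subfield is identified with \<open>K\<close> by the Frobenius map, so \<open>c\<close> acts as multiplication by \<open>c\<^sup>2\<close>.
\<close>

definition ore_code :: "(nat, nat) module" where
  "ore_code = \<lparr>carrier = range (to_nat :: 'a poly \<Rightarrow> nat),
     monoid.mult = \<lambda>p q. to_nat (ore_mult (from_nat p) (from_nat q)), monoid.one = to_nat (1 :: 'a poly),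
     ring.zero = to_nat (0 :: 'a poly), ring.add = \<lambda>p q. to_nat (from_nat p + from_nat q :: 'a poly),
     module.smult = \<lambda>c p. to_nat (smult ((from_nat c :: 'a)\<^sup>2) (from_nat p))\<rparr>"

lemma square_add: "(a + b)\<^sup>2 = a\<^sup>2 + (b::'a)\<^sup>2"
proof -
  have "(a + b)\<^sup>2 = a\<^sup>2 + b\<^sup>2 + (a * b + a * b)"
    by (simp only: power2_eq_square algebra_simps)
  then show ?thesis by (simp only: double add_0_right)
qed

lemma square_constant: "\<delta> (c\<^sup>2) = 0"
  using double[of "c * \<delta> c"] by (simp add: power2_eq_square Leibniz mult.commute)

lemma poly_double: "p + p = (0 :: 'a poly)"
  by (rule poly_eqI) (simp only: coeff_add double coeff_0)

lemma poly_diff_eq_add: "p - q = p + (q :: 'a poly)"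
  using poly_double[of q] by (metis add_diff_cancel_right' add.assoc add_0_right)

lemma assoc_algebra_ore_code: "assoc_algebra (field_code TYPE('a)) ore_code"
proof -
  let ?F = "field_code TYPE('a)" and ?A = ore_code
  interpret F: field ?F by (rule field_field_code)
  have ab: "abelian_group ?A"
  proof (rule abelian_groupI)
    fix x assume "x \<in> carrier ?A"
    then obtain p :: "'a poly" where "x = to_nat p" by (auto simp: ore_code_def)
    then show "\<exists>y\<in>carrier ?A. y \<oplus>\<^bsub>?A\<^esub> x = \<zero>\<^bsub>?A\<^esub>"
      by (intro bexI[of _ "to_nat (- p)"]) (auto simp: ore_code_def)
  qed (auto simp: ore_code_def add_ac)
  have "monoid ?A"
    by (rule monoidI) (auto simp: ore_code_def ore_mult_assoc)
  with ab have "ring ?A"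
    by (rule ringI) (auto simp: ore_code_def ore_mult_add_left ore_mult_add_right)
  moreover have "module ?F ?A"
    by (rule moduleI[OF F.cring_axioms ab])
      (auto simp: ore_code_def field_code_def square_add smult_add_left smult_add_right power_mult_distrib)
  ultimately show ?thesis
    by (intro assoc_algebra.intro field_field_code assoc_algebra_axioms.intro)
      (auto simp: ore_code_def field_code_def ore_mult_smult_left ore_mult_smult_constant square_constant)
qed

text \<open>
  The algebra is affine as soon as \<open>K\<close> is generated over its squares by the iterated derivatives of finitely
  many elements: these and \<open>x\<close> suffice, because \<open>\<delta>(a) = x a - a x\<close>.
\<close>

lemma affine_ore_code:
  assumes "finite G"
    and gen: "\<And>C. \<lbrakk>G \<subseteq> C; 1 \<in> C; \<And>a b. a \<in> C \<Longrightarrow> b \<in> C \<Longrightarrow> a + b \<in> C;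
      \<And>a b. a \<in> C \<Longrightarrow> b \<in> C \<Longrightarrow> a * b \<in> C; \<And>c a. a \<in> C \<Longrightarrow> c\<^sup>2 * a \<in> C;
      \<And>a. a \<in> C \<Longrightarrow> \<delta> a \<in> C\<rbrakk> \<Longrightarrow> C = (UNIV :: 'a set)"
  shows "affine_algebra (field_code TYPE('a)) ore_code"
proof -
  let ?F = "field_code TYPE('a)" and ?A = ore_code
  let ?S = "insert (to_nat [:0, 1 :: 'a:]) ((\<lambda>c. to_nat [:c:]) ` G)"
  have S: "?S \<subseteq> carrier ?A" by (auto simp: ore_code_def)
  have full: "carrier ?A \<subseteq> B" if B: "unital_subalgebra ?F B ?A" "?S \<subseteq> B" for B
  proof -
    have sub: "subring B ?A" and B_smult: "\<And>c x. c \<in> carrier ?F \<Longrightarrow> x \<in> B \<Longrightarrow> c \<odot>\<^bsub>?A\<^esub> x \<in> B"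
      using B by (auto simp: unital_subalgebra_def)
    define J where "J = {p :: 'a poly. to_nat p \<in> B}"
    have J_1: "1 \<in> J" and J_add: "\<And>p q. p \<in> J \<Longrightarrow> q \<in> J \<Longrightarrow> p + q \<in> J"
      and J_mult: "\<And>p q. p \<in> J \<Longrightarrow> q \<in> J \<Longrightarrow> ore_mult p q \<in> J"
      using subringE(3,6,7)[OF sub] by (force simp: J_def ore_code_def)+
    have J_smult: "smult (c\<^sup>2) p \<in> J" if "p \<in> J" for c p
      using B_smult[of "to_nat c" "to_nat p"] that by (simp add: J_def ore_code_def field_code_def)
    have J_x: "[:0, 1:] \<in> J" and J_G: "\<And>c. c \<in> G \<Longrightarrow> [:c:] \<in> J"
      using B(2) by (auto simp: J_def)
    have "{c. [:c:] \<in> J} = UNIV"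
    proof (rule gen)
      fix a b assume "a \<in> {c. [:c:] \<in> J}" "b \<in> {c. [:c:] \<in> J}"
      then show "a + b \<in> {c. [:c:] \<in> J}" "a * b \<in> {c. [:c:] \<in> J}"
        using J_add[of "[:a:]" "[:b:]"] J_mult[of "[:a:]" "[:b:]"] by auto
    next
      fix c a assume "a \<in> {c. [:c:] \<in> J}"
      then show "c\<^sup>2 * a \<in> {c. [:c:] \<in> J}"
        using J_smult[of "[:a:]" c] by simp
    next
      fix a assume a: "a \<in> {c. [:c:] \<in> J}"
      \<comment> \<open>The commutator; addition and subtraction agree in characteristic 2.\<close>
      have eq: "[:\<delta> a:] = ore_mult [:0, 1:] [:a:] + ore_mult [:a:] [:0, 1:]"
        using double[of a] by (simp add: xmult_pCons)
      have "ore_mult [:0, 1:] [:a:] + ore_mult [:a:] [:0, 1:] \<in> J"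
        using a J_x by (intro J_add J_mult) auto
      then show "\<delta> a \<in> {c. [:c:] \<in> J}"
        by (simp only: eq mem_Collect_eq)
    qed (use J_1 J_G in \<open>auto simp: one_pCons\<close>)
    then have const: "[:c:] \<in> J" for c by blast
    have "p \<in> J" for p
    proof (induction p)
      case 0
      then show ?case using const[of 0] by simp
    next
      case (pCons c p)
      have "pCons c p = [:c:] + ore_mult p [:0, 1:]" by simp
      with J_add J_mult const J_x pCons show ?case by metis
    qed
    then show ?thesis by (auto simp: J_def ore_code_def)
  qed
  interpret A: assoc_algebra ?F ?A by (rule assoc_algebra_ore_code)
  have "unital_subalgebra ?F (carrier ?A) ?A"
    using A.carrier_is_subring A.smult_closed by (simp add: unital_subalgebra_def)
  with S have "generated_subalgebra ?F ?S ?A \<subseteq> carrier ?A"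
    unfolding generated_subalgebra_def by blast
  moreover have "carrier ?A \<subseteq> generated_subalgebra ?F ?S ?A"
    unfolding generated_subalgebra_def using full by blast
  ultimately show ?thesis
    unfolding affine_algebra_def using S \<open>finite G\<close> assoc_algebra_ore_code
    by (intro conjI exI[of _ ?S]) auto
qed

lemma ideal_chain_stabilises:
  fixes I :: "nat \<Rightarrow> nat set"
  assumes "mono I" "\<And>n. additive_subgroup (I n) ore_code"
    and "\<And>n f (g :: 'a poly). \<lbrakk>to_nat g \<in> I n; g \<noteq> 0; f \<noteq> 0; degree g \<le> degree f\<rbrakk> \<Longrightarrow>
      \<exists>h. to_nat (h :: 'a poly) \<in> I n \<and> length (coeffs (f - h)) < length (coeffs f)"
  shows "\<exists>N. \<forall>n\<ge>N. I n = I N"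
proof -
  define J where "J n = {p :: 'a poly. to_nat p \<in> I n}" for n
  have I: "I n = to_nat ` J n" for n
    using additive_subgroup.a_subset[OF assms(2), of n] by (auto simp: J_def ore_code_def)
  have "\<exists>N. \<forall>n\<ge>N. J n = J N"
  proof (rule chain_stabilises)
    show "mono J"
      using \<open>mono I\<close> unfolding J_def mono_def by blast
    show "0 \<in> J n" for n
      using additive_subgroup.zero_closed[OF assms(2), of n] by (simp add: J_def ore_code_def)
    show "f - h \<in> J n" if "f \<in> J n" "h \<in> J n" for n f h
      using additive_subgroup.a_closed[OF assms(2), of "to_nat f" n "to_nat h"] that
      by (simp add: J_def ore_code_def poly_diff_eq_add)
  qed (use assms(3) in \<open>auto simp: J_def\<close>)
  then show ?thesis by (auto simp: I)
qed

lemma two_sided_noetherian_ore_code: "two_sided_noetherian ore_code"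
proof -
  interpret A: assoc_algebra "field_code TYPE('a)" ore_code by (rule assoc_algebra_ore_code)
  have "\<exists>N. \<forall>n\<ge>N. I n = I N" if I: "\<And>n. left_ideal (I n) ore_code" "mono I" for I :: "nat \<Rightarrow> nat set"
  proof (rule ideal_chain_stabilises)
    fix n and f g :: "'a poly"
    assume g: "to_nat g \<in> I n" and "g \<noteq> 0" "f \<noteq> 0" "degree g \<le> degree f"
    then obtain p where "length (coeffs (f - ore_mult p g)) < length (coeffs f)"
      using left_division_step by blast
    moreover have "to_nat (ore_mult p g) \<in> I n"
      using left_ideal.left_closed[OF I(1) g, of "to_nat p"] by (simp add: ore_code_def)
    ultimately show "\<exists>h. to_nat h \<in> I n \<and> length (coeffs (f - h)) < length (coeffs f)" by blast
  qed (use I left_ideal.axioms in auto)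
  moreover have "\<exists>N. \<forall>n\<ge>N. I n = I N" if I: "\<And>n. right_ideal (I n) ore_code" "mono I" for I :: "nat \<Rightarrow> nat set"
  proof (rule ideal_chain_stabilises)
    fix n and f g :: "'a poly"
    assume g: "to_nat g \<in> I n" and "g \<noteq> 0" "f \<noteq> 0" "degree g \<le> degree f"
    then obtain p where "length (coeffs (f - ore_mult g p)) < length (coeffs f)"
      using right_division_step by blast
    moreover have "to_nat (ore_mult g p) \<in> I n"
      using right_ideal.right_closed[OF I(1) g, of "to_nat p"] by (simp add: ore_code_def)
    ultimately show "\<exists>h. to_nat h \<in> I n \<and> length (coeffs (f - h)) < length (coeffs f)" by blast
  qed (use I right_ideal.axioms in auto)
  ultimately show ?thesis
    unfolding two_sided_noetherian_def left_noetherian_def right_noetherian_def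
    using A.ring_axioms by blast
qed

end

lemma isomorphic_ore_codes:
  fixes \<delta> \<delta>' :: "'a::{field, countable} \<Rightarrow> 'a"
  assumes "char2_derivation \<delta>" "char2_derivation \<delta>'"
    and iso: "algebra_isomorphic (field_code TYPE('a))
      (char2_derivation.ore_code \<delta>) (char2_derivation.ore_code \<delta>')"
  shows "\<exists>a. \<forall>c. \<delta> c = a * \<delta>' c"
proof -
  interpret A: char2_derivation \<delta> by fact
  interpret B: char2_derivation \<delta>' by fact
  from iso obtain g where hom: "g \<in> ring_hom A.ore_code B.ore_code"
    and bij: "bij_betw g (carrier A.ore_code) (carrier B.ore_code)"
    and lin: "\<And>c x. c \<in> carrier (field_code TYPE('a)) \<Longrightarrow> x \<in> carrier A.ore_code \<Longrightarrow>
      g (c \<odot>\<^bsub>A.ore_code\<^esub> x) = c \<odot>\<^bsub>B.ore_code\<^esub> g x"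
    unfolding algebra_isomorphic_def ring_iso_def by blast
  define h :: "'a poly \<Rightarrow> 'a poly" where "h p = from_nat (g (to_nat p))" for p
  have range: "g ` range (to_nat :: 'a poly \<Rightarrow> nat) = range (to_nat :: 'a poly \<Rightarrow> nat)"
    using bij by (simp add: bij_betw_def A.ore_code_def B.ore_code_def)
  then have "\<exists>q :: 'a poly. g (to_nat p) = to_nat q" for p :: "'a poly"
    by blast
  then have g: "g (to_nat p) = to_nat (h p)" for p
    unfolding h_def by (metis from_nat_to_nat)
  show ?thesis
  proof (rule ore_hom_rigid)
    show "surj h"
    proof (rule surjI)
      fix q
      show "h (SOME p. h p = q) = q"
      proof (rule someI_ex)
        have "to_nat q \<in> g ` range (to_nat :: 'a poly \<Rightarrow> nat)" using range by simp
        then show "\<exists>p. h p = q" by (auto simp: g)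
      qed
    qed
    show "h (p + q) = h p + h q" for p q
      using ring_hom_add[OF hom, of "to_nat p" "to_nat q"] by (simp add: A.ore_code_def B.ore_code_def g)
    show "h (A.ore_mult p q) = B.ore_mult (h p) (h q)" for p q
      using ring_hom_mult[OF hom, of "to_nat p" "to_nat q"] by (simp add: A.ore_code_def B.ore_code_def g)
    show one: "h 1 = 1"
      using ring_hom_one[OF hom] by (simp add: A.ore_code_def B.ore_code_def g)
    show "h [:c\<^sup>2:] = [:c\<^sup>2:]" for c
    proof -
      have "h (smult (c\<^sup>2) 1) = smult (c\<^sup>2) (h 1)"
        using lin[of "to_nat c" "to_nat (1 :: 'a poly)"]
        by (simp add: A.ore_code_def B.ore_code_def field_code_def g)
      then show ?thesis unfolding one by (simp add: one_pCons)
    qed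
  qed (use A.double A.derivation_axioms B.derivation_axioms in auto)
qed

section \<open>A continuum of pairwise non-isomorphic algebras\<close>

text \<open>
  The derivation of \<open>K\<close> attached to a set \<open>S\<close>: it sends \<open>t\<^sub>i\<close> to \<open>t\<^sub>i\<^sub>+\<^sub>1\<close>, plus \<open>1\<close> if \<open>i\<close> is the successor of an
  element of \<open>S\<close>. As
  \<open>t\<^sub>0\<close> always goes to \<open>t\<^sub>1\<close>, distinct derivations of the family are never proportional.
\<close>

definition shift_derivation :: "nat set \<Rightarrow> function_field \<Rightarrow> function_field" where
  "shift_derivation S = (SOME \<delta>. derivation \<delta> \<and>
     (\<forall>i. \<delta> (indet i) = indet (Suc i) + (if i \<in> Suc ` S then 1 else 0)))"

lemma derivation_shift: "derivation (shift_derivation S)"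
  and shift_derivation_indet:
    "shift_derivation S (indet i) = indet (Suc i) + (if i \<in> Suc ` S then 1 else 0)"
  using someI_ex[OF derivation_prescribed, of "\<lambda>i. indet (Suc i) + (if i \<in> Suc ` S then 1 else 0)"]
  unfolding shift_derivation_def by auto

interpretation shift: char2_derivation "shift_derivation S" for S
  by (intro char2_derivation.intro derivation_shift char2_derivation_axioms.intro function_field_double)

text \<open>
  The algebra \<open>K[x; \<delta>]\<close> for the derivation attached to \<open>S\<close>.
\<close>

definition shift_algebra :: "nat set \<Rightarrow> (nat, nat) module" where
  "shift_algebra S = char2_derivation.ore_code (shift_derivation S)"

lemma affine_shift_algebra: "affine_algebra (field_code TYPE(function_field)) (shift_algebra S)"
  unfolding shift_algebra_def
proof (rule shift.affine_ore_code[of "{indet 0}"])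
  fix C :: "function_field set"
  assume C: "{indet 0} \<subseteq> C" "1 \<in> C" "\<And>a b. a \<in> C \<Longrightarrow> b \<in> C \<Longrightarrow> a + b \<in> C"
    "\<And>a b. a \<in> C \<Longrightarrow> b \<in> C \<Longrightarrow> a * b \<in> C" "\<And>c a. a \<in> C \<Longrightarrow> c\<^sup>2 * a \<in> C"
    "\<And>a. a \<in> C \<Longrightarrow> shift_derivation S a \<in> C"
  have "0 \<in> C"
    using C(5)[OF C(2), of 0] by simp
  have "indet i \<in> C" for i
  proof (induction i)
    case (Suc i)
    define e :: function_field where "e = (if i \<in> Suc ` S then 1 else 0)"
    have "indet (Suc i) = shift_derivation S (indet i) + e"
      using function_field_double[of e] by (simp only: shift_derivation_indet e_def[symmetric] add.assoc add_0_right)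
    moreover have "e \<in> C"
      using \<open>0 \<in> C\<close> C(2) by (simp add: e_def)
    ultimately show ?case using C Suc by simp
  qed (use C in simp)
  with C show "C = UNIV" by (intro generated_by_indets) auto
qed simp

lemma isomorphic_shift_algebras:
  assumes "algebra_isomorphic (field_code TYPE(function_field)) (shift_algebra S) (shift_algebra T)"
  shows "S = T"
proof -
  obtain a where a: "\<And>c. shift_derivation S c = a * shift_derivation T c"
    using isomorphic_ore_codes[OF shift.char2_derivation_axioms shift.char2_derivation_axioms, of S T]
      assms unfolding shift_algebra_def by blast
  have "a = 1"
    using a[of "indet 0"] indet_nonzero[of 1] by (simp add: shift_derivation_indet image_iff)
  then have "i \<in> Suc ` S \<longleftrightarrow> i \<in> Suc ` T" for i
    using a[of "indet i"] by (simp add: shift_derivation_indet split: if_splits)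
  then have "Suc ` S = Suc ` T" by blast
  then show "S = T" by (simp add: inj_image_eq_iff)
qed

theorem theorem1p3:
  shows "\<exists>(F :: nat ring) (\<A> :: (nat, nat) module set).
           field F \<and> countable (carrier F) \<and>
           \<A> \<approx> (UNIV :: nat set set) \<and>
           (\<forall>A\<in>\<A>. assoc_algebra F A \<and> affine_algebra F A \<and> two_sided_noetherian A) \<and>
           pairwise (\<lambda>A B. \<not> algebra_isomorphic F A B) \<A>"
proof (intro exI conjI)
  let ?F = "field_code TYPE(function_field)" and ?\<A> = "range shift_algebra"
  show "field ?F" by (rule field_field_code)
  show "countable (carrier ?F)" by simp
  show "?\<A> \<approx> (UNIV :: nat set set)"
  proof (rule inj_on_image_eqpoll_self, rule injI)
    fix S T assume eq: "shift_algebra S = shift_algebra T"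
    interpret assoc_algebra ?F "shift_algebra T"
      unfolding shift_algebra_def by (rule shift.assoc_algebra_ore_code)
    have "algebra_isomorphic ?F (shift_algebra S) (shift_algebra T)"
      unfolding algebra_isomorphic_def eq by (intro bexI[of _ id]) (simp_all add: ring_iso_set_refl)
    then show "S = T" by (rule isomorphic_shift_algebras)
  qed
  show "\<forall>A\<in>?\<A>. assoc_algebra ?F A \<and> affine_algebra ?F A \<and> two_sided_noetherian A"
    using affine_shift_algebra shift.assoc_algebra_ore_code shift.two_sided_noetherian_ore_code
    by (auto simp: shift_algebra_def)
  show "pairwise (\<lambda>A B. \<not> algebra_isomorphic ?F A B) ?\<A>"
    using isomorphic_shift_algebras by (auto simp: pairwise_def)
qed

end
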